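(* Let $V_0,V_1,V_2$ be finite-dimensional Hilbert spaces forming an exact sequence $$\ker(\mathrm d_0)\xrightarrow{\subset}V_0\xrightarrow{\mathrm d_0}V_1\xrightarrow{\mathrm d_1}V_2\to0 .$$ Let $\mathrm d_2$ be a linear operator on $V_0$ and $s^*$ a linear operator on $V_1$ (with a common target space) such that $s^*\mathrm d_0=\mathrm d_2$. Let $W\subseteq s^*(V_1)$ be a subspace, and define $$\widehat V_0=\{u\in V_0:\mathrm d_2u\in W\},\qquad \widehat V_1=\{v\in V_1:s^*v\in W\}.$$ Assume $\ker(\mathrm d_0)\subset\widehat V_0$. Additionally assume that $\dim V_0-\dim\widehat V_0=\dim V_1-\dim\widehat V_1$ (equivalently, $\dim \mathrm d_2V_0-\dim\mathrm d_2\widehat V_0=\dim s^*V_1-\dim s^*\widehat V_1$). Then $$\ker(\mathrm d_0)\xrightarrow{\subset}\widehat V_0\xrightarrow{\mathrm d_0}\widehat V_1\xrightarrow{\mathrm d_1}V_2\to0$$ is an exact sequence.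
   Context: Exactness of $\ker(\mathrm d_0)\to V_0\to V_1\to V_2\to0$ means $\ker(\mathrm d_1)=\mathrm d_0(V_0)$ and $\mathrm d_1(V_1)=V_2$, where $\mathrm d_0:V_0\to V_1$, $\mathrm d_1:V_1\to V_2$ are linear. *)

theory Defs
  imports "HOL-Analysis.Analysis"
begin

(* A finite-dimensional (real) Hilbert space is a finite-dimensional linear subspace of some type
   of class real_inner, with the induced inner product; completeness is automatic.  Spaces are
   carriers rather than types of class euclidean_space because those cannot have dimension 0.
   Complex Hilbert spaces are covered by restriction of scalars (inner product Re <x,y>). *)
definition fin_dim_hilbert :: "'a::real_inner set \<Rightarrow> bool" where
  "fin_dim_hilbert V \<longleftrightarrow> subspace V \<and> (\<exists>B. finite B \<and> span B = V)"

(* f is a linear map from the space V to the space W; values of f outside V are irrelevant. *)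
definition linear_map_on :: "'a::real_vector set \<Rightarrow> 'b::real_vector set \<Rightarrow> ('a \<Rightarrow> 'b) \<Rightarrow> bool" where
  "linear_map_on V W f \<longleftrightarrow>
     subspace V \<and> subspace W \<and> f ` V \<subseteq> W \<and>
     (\<forall>x\<in>V. \<forall>y\<in>V. f (x + y) = f x + f y) \<and>
     (\<forall>c. \<forall>x\<in>V. f (c *\<^sub>R x) = c *\<^sub>R f x)"

definition ker_on :: "'a set \<Rightarrow> ('a \<Rightarrow> 'b::zero) \<Rightarrow> 'a set" where
  "ker_on V f = {x \<in> V. f x = 0}"

(* Exactness of  K --inclusion--> V0 --d0--> V1 --d1--> V2 --> 0
   at V0, V1 and V2 respectively. *)
definition exact_sequence ::
  "'a::real_vector set \<Rightarrow> 'a set \<Rightarrow> ('a \<Rightarrow> 'b::real_vector) \<Rightarrow> 'b set \<Rightarrow> ('b \<Rightarrow> 'c::real_vector) \<Rightarrow> 'c set \<Rightarrow> bool"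
where
  "exact_sequence K V0 d0 V1 d1 V2 \<longleftrightarrow>
     linear_map_on V0 V1 d0 \<and> linear_map_on V1 V2 d1 \<and>
     K \<subseteq> V0 \<and> ker_on V0 d0 = K \<and>
     ker_on V1 d1 = d0 ` V0 \<and>
     d1 ` V1 = V2"

end

theory Submission
  imports Defs
begin

text \<open>
  Both claims are dimension counts with the rank-nullity theorem.  Since \<open>0 \<in> W\<close>, the kernels of
  \<open>d2\<close> on \<open>V0\<close> and of \<open>s\<close> on \<open>V1\<close> lie in \<open>V0h\<close> and \<open>V1h\<close>.  Restricting \<open>d2\<close> or \<open>s\<close> to the
  smaller space therefore leaves the nullity unchanged, so the drop in dimension of the space
  equals the drop in rank; this gives the equivalence of the two dimension conditions.

  For exactness, \<open>s (d0 u) = d2 u\<close> says that \<open>u \<in> V0\<close> lies in \<open>V0h\<close> iff \<open>d0 u\<close> lies in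
  \<open>V1h\<close>.  Hence \<open>d0\<close> maps \<open>V0h\<close> into \<open>V1h\<close>, and the kernel of \<open>d1\<close> on \<open>V1h\<close>, which is
  \<open>d0 ` V0 \<inter> V1h\<close>, equals \<open>d0 ` V0h\<close>.  Exactness at \<open>V0h\<close> is the hypothesis that \<open>V0h\<close>
  contains the kernel of \<open>d0\<close>.  Only surjectivity of \<open>d1\<close> on \<open>V1h\<close> needs the dimension
  condition: the alternating sum of the dimensions along an exact sequence vanishes, and comparing
  these sums for \<open>V0, V1, V2\<close> and for \<open>V0h, V1h, d1 ` V1h\<close>, where the kernel of \<open>d0\<close> is the
  same, yields
  \<open>dim (d1 ` V1h) = dim V2\<close>, so that the subspace \<open>d1 ` V1h\<close> is all of \<open>V2\<close>.
\<close>

lemma span_Int_span_disjoint: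
  fixes B C :: "'a::real_vector set"
  assumes "independent (B \<union> C)" and "B \<inter> C = {}"
    and "x \<in> span B" and "x \<in> span C"
  shows "x = 0"
proof -
  let ?r = "real_vector.representation"
  have "?r (B \<union> C) x = ?r B x" "?r (B \<union> C) x = ?r C x"
    using assms by (auto intro!: real_vector.representation_extend)
  then have "?r B x b = 0" for b
    using assms(2) real_vector.representation_ne_zero[of B x b]
      real_vector.representation_ne_zero[of C x b] by auto
  moreover have "independent B"
    using assms(1) real_vector.independent_mono by blast
  ultimately show "x = 0"
    using real_vector.sum_nonzero_representation_eq[of B x] assms(3) by simp
qed

text \<open>
  A map that is linear only on a carrier agrees there with a linear map on the whole type, so
  results about the predicate \<open>linear\<close> become applicable.
\<close>
lemma linear_map_on_extend:
  assumes "linear_map_on V W f"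
  obtains g where "linear g" and "\<And>x. x \<in> V \<Longrightarrow> g x = f x"
proof -
  obtain B where B: "B \<subseteq> V" "independent B" "V \<subseteq> span B"
    using real_vector.maximal_independent_subset[of V] by blast
  obtain g where g: "linear g" "\<forall>x\<in>B. g x = f x"
    using linear_independent_extend[OF B(2)] by blast
  have V: "subspace V" and f: "\<And>x y. x \<in> V \<Longrightarrow> y \<in> V \<Longrightarrow> f (x + y) = f x + f y"
      "\<And>c x. x \<in> V \<Longrightarrow> f (c *\<^sub>R x) = c *\<^sub>R f x"
    using assms unfolding linear_map_on_def by auto
  have "subspace {x \<in> V. g x = f x}"
    using V f f(2)[of 0 0] g(1)
    by (auto intro!: subspaceI simp: subspace_0 subspace_add subspace_scale
        linear_add linear_scale linear_0)
  then have "span B \<subseteq> {x \<in> V. g x = f x}"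
    using B(1) g(2) by (intro span_minimal) auto
  with B(3) g(1) show thesis
    using that by blast
qed

lemma linear_map_on_zero:
  assumes "linear_map_on V W f"
  shows "f 0 = 0"
proof -
  have "0 \<in> V"
    using assms by (simp add: linear_map_on_def subspace_0)
  then have "f (0 *\<^sub>R 0) = 0 *\<^sub>R f 0"
    using assms unfolding linear_map_on_def by blast
  then show ?thesis by simp
qed

lemma linear_map_on_subset:
  assumes "linear_map_on V W f" and "subspace U" and "U \<subseteq> V" and "subspace X" and "f ` U \<subseteq> X"
  shows "linear_map_on U X f"
  using assms unfolding linear_map_on_def by blast

lemma subspace_linear_map_on_image:
  assumes "linear_map_on V W f"
  shows "subspace (f ` V)"
proof -
  obtain g where g: "linear g" "\<And>x. x \<in> V \<Longrightarrow> g x = f x"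
    using linear_map_on_extend[OF assms] by blast
  have "f ` V = g ` V"
    using g(2) by simp
  moreover have "subspace V"
    using assms by (simp add: linear_map_on_def)
  ultimately show ?thesis
    using g(1) linear_subspace_image by metis
qed

lemma subspace_linear_map_on_preimage:
  assumes "linear_map_on V UNIV f" and "subspace W"
  shows "subspace {x \<in> V. f x \<in> W}"
proof -
  have "f 0 = 0"
    using assms(1) by (rule linear_map_on_zero)
  then show ?thesis
    using assms unfolding linear_map_on_def
    by (auto intro!: subspaceI simp: subspace_0 subspace_add subspace_scale)
qed

text \<open>
  Rank-nullity: extend a basis of the kernel to a basis of \<open>V\<close>; the map is injective on the span of
  the added vectors, whose images therefore form a basis of the image.  The ambient types may be
  infinite-dimensional, hence the explicit finite spanning set.
\<close>
lemma dim_image_plus_dim_ker_on: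
  assumes f: "linear_map_on V W f" and "finite S" and "V \<subseteq> span S"
  shows "dim V = dim (f ` V) + dim (ker_on V f)"
proof -
  obtain g where g: "linear g" and gf: "\<And>x. x \<in> V \<Longrightarrow> g x = f x"
    using linear_map_on_extend[OF f] by blast
  have V: "subspace V"
    using f by (simp add: linear_map_on_def)
  obtain K where K: "K \<subseteq> ker_on V f" "independent K" "ker_on V f \<subseteq> span K"
      "card K = dim (ker_on V f)"
    using real_vector.basis_exists by blast
  have "K \<subseteq> V"
    using K(1) by (auto simp: ker_on_def)
  then obtain B where B: "K \<subseteq> B" "B \<subseteq> V" "independent B" "V \<subseteq> span B"
    using real_vector.maximal_independent_subset_extend[OF _ K(2)] by blast
  have finB: "finite B"
    using real_vector.independent_span_bound[OF assms(2) B(3)] B(2) assms(3) by blast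
  have inj: "inj_on g (span (B - K))"
  proof -
    have "x = 0" if x: "x \<in> span (B - K)" "g x = 0" for x
    proof -
      have "x \<in> V"
        using x(1) B(2) V by (meson Diff_subset span_minimal subsetD subset_trans)
      then have "x \<in> span K"
        using x(2) gf K(3) by (auto simp: ker_on_def)
      then show "x = 0"
        using span_Int_span_disjoint[of K "B - K" x] x(1) B(1,3) by (simp add: Un_absorb1)
    qed
    then show ?thesis
      using linear_inj_on_iff_eq_0[OF g, of "span (B - K)"] by simp
  qed
  have ind: "independent (g ` (B - K))"
    using linear_independent_injective_image[OF g _ inj] B(3) real_vector.independent_mono by blast
  have "g ` B \<subseteq> span (g ` (B - K))"
  proof
    fix y assume "y \<in> g ` B"
    then obtain b where b: "b \<in> B" "y = g b" by blast
    show "y \<in> span (g ` (B - K))"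
    proof (cases "b \<in> K")
      case True
      then have "y = 0"
        using K(1) b gf by (auto simp: ker_on_def)
      then show ?thesis by (simp add: span_zero)
    qed (use b in \<open>simp add: span_base\<close>)
  qed
  moreover have "g ` V \<subseteq> span (g ` B)"
    using linear_spans_image[OF g B(4)] .
  ultimately have "g ` V \<subseteq> span (g ` (B - K))"
    by (meson span_minimal subspace_span subset_trans)
  moreover have "g ` (B - K) \<subseteq> g ` V"
    using B(2) by blast
  ultimately have "dim (g ` V) = card (g ` (B - K))"
    using ind real_vector.basis_card_eq_dim by metis
  also have "\<dots> = card (B - K)"
    using inj by (intro card_image) (meson inj_on_subset span_superset)
  finally have "dim (f ` V) = card (B - K)"
    using gf by (simp cong: image_cong)
  moreover have "card B = card (B - K) + card K"
    using finB B(1) by (metis card_Diff_subset card_mono finite_subset le_add_diff_inverse2)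
  moreover have "card B = dim V"
    using B real_vector.basis_card_eq_dim by blast
  ultimately show ?thesis
    using K(4) by simp
qed

lemma subspace_eq_of_dim_eq:
  fixes U V :: "'a::real_vector set"
  assumes "subspace U" and "U \<subseteq> V" and "dim U = dim V" and "finite S" and "V \<subseteq> span S"
  shows "U = V"
proof -
  obtain B where B: "B \<subseteq> U" "independent B" "U \<subseteq> span B" "card B = dim U"
    using real_vector.basis_exists by blast
  have "B \<subseteq> V"
    using B(1) assms(2) by blast
  then obtain C where C: "B \<subseteq> C" "C \<subseteq> V" "independent C" "V \<subseteq> span C"
    using real_vector.maximal_independent_subset_extend[OF _ B(2)] by blast
  have "finite C"
    using real_vector.independent_span_bound[OF assms(4) C(3)] C(2) assms(5) by blast
  moreover have "card C = dim V"
    using C real_vector.basis_card_eq_dim by blast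
  ultimately have "B = C"
    using C(1) B(4) assms(3) by (metis card_subset_eq)
  then have "V \<subseteq> U"
    using C(4) B(1) assms(1) by (metis span_minimal subset_trans)
  with assms(2) show ?thesis by blast
qed

text \<open>Passing to the preimage of a subspace leaves the kernel, hence the nullity, unchanged.\<close>
lemma dim_diff_preimage:
  assumes f: "linear_map_on V UNIV f" and W: "subspace W" and S: "finite S" "V \<subseteq> span S"
    and U: "U = {x \<in> V. f x \<in> W}"
  shows "int (dim V) - int (dim U) = int (dim (f ` V)) - int (dim (f ` U))"
proof -
  have "linear_map_on U UNIV f"
    using linear_map_on_subset[OF f] subspace_linear_map_on_preimage[OF f W] U by auto
  moreover have "U \<subseteq> span S"
    using U S(2) by auto
  ultimately have "dim U = dim (f ` U) + dim (ker_on U f)"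
    using dim_image_plus_dim_ker_on S(1) by blast
  moreover have "dim V = dim (f ` V) + dim (ker_on V f)"
    using dim_image_plus_dim_ker_on f S by blast
  moreover have "ker_on U f = ker_on V f"
    using U subspace_0[OF W] by (auto simp: ker_on_def)
  ultimately show ?thesis by simp
qed

lemma exact_sequence_dim:
  assumes ex: "exact_sequence K V0 d0 V1 d1 V2"
    and "finite S" "V0 \<subseteq> span S" and "finite T" "V1 \<subseteq> span T"
  shows "dim K + dim V1 = dim V0 + dim V2"
proof -
  have "dim V0 = dim (d0 ` V0) + dim (ker_on V0 d0)"
    using ex assms(2,3) dim_image_plus_dim_ker_on unfolding exact_sequence_def by blast
  moreover have "dim V1 = dim (d1 ` V1) + dim (ker_on V1 d1)"
    using ex assms(4,5) dim_image_plus_dim_ker_on unfolding exact_sequence_def by blast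
  ultimately show ?thesis
    using ex unfolding exact_sequence_def by simp
qed

text \<open>Without the dimension condition, exactness can fail only at the last space.\<close>
lemma exact_sequence_restrict:
  assumes ex: "exact_sequence K V0 d0 V1 d1 V2"
    and U0: "subspace U0" "U0 \<subseteq> V0" and U1: "subspace U1" "U1 \<subseteq> V1"
    and pre: "\<And>u. u \<in> V0 \<Longrightarrow> d0 u \<in> U1 \<longleftrightarrow> u \<in> U0" and K: "K \<subseteq> U0"
  shows "exact_sequence K U0 d0 U1 d1 (d1 ` U1)"
proof -
  have l0: "linear_map_on V0 V1 d0" and l1: "linear_map_on V1 V2 d1"
    and k0: "ker_on V0 d0 = K" and k1: "ker_on V1 d1 = d0 ` V0"
    using ex by (auto simp: exact_sequence_def)
  have "d0 ` U0 \<subseteq> U1"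
    using pre U0(2) by auto
  then have "linear_map_on U0 U1 d0"
    by (rule linear_map_on_subset[OF l0 U0 U1(1)])
  moreover have "linear_map_on U1 (d1 ` U1) d1"
  proof -
    have "linear_map_on U1 UNIV d1"
      by (rule linear_map_on_subset[OF l1 U1]) auto
    then have "subspace (d1 ` U1)"
      by (rule subspace_linear_map_on_image)
    then show ?thesis
      by (rule linear_map_on_subset[OF l1 U1]) simp
  qed
  moreover have "ker_on U0 d0 = K"
    using k0 K U0(2) by (auto simp: ker_on_def)
  moreover have "ker_on U1 d1 = d0 ` U0"
  proof -
    have "ker_on U1 d1 = ker_on V1 d1 \<inter> U1"
      using U1(2) by (auto simp: ker_on_def)
    also have "\<dots> = d0 ` U0"
      using k1 pre U0(2) by auto
    finally show ?thesis .
  qed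
  ultimately show ?thesis
    using K by (simp add: exact_sequence_def)
qed

theorem lemma2p2:
  fixes V0 V0h :: "'a::real_inner set"
    and V1 V1h :: "'b::real_inner set"
    and V2 :: "'c::real_inner set"
    and W :: "'d::real_vector set"
    and d0 :: "'a \<Rightarrow> 'b" and d1 :: "'b \<Rightarrow> 'c"
    and d2 :: "'a \<Rightarrow> 'd" and s :: "'b \<Rightarrow> 'd"
  assumes "fin_dim_hilbert V0" and "fin_dim_hilbert V1" and "fin_dim_hilbert V2"
    and "exact_sequence (ker_on V0 d0) V0 d0 V1 d1 V2"
    and "linear_map_on V0 UNIV d2" and "linear_map_on V1 UNIV s"
    and "\<forall>u\<in>V0. s (d0 u) = d2 u"
    and "subspace W" and "W \<subseteq> s ` V1"
    and "V0h = {u \<in> V0. d2 u \<in> W}"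
    and "V1h = {v \<in> V1. s v \<in> W}"
    and "ker_on V0 d0 \<subseteq> V0h"
  shows "(int (dim V0) - int (dim V0h) = int (dim V1) - int (dim V1h) \<longleftrightarrow>
          int (dim (d2 ` V0)) - int (dim (d2 ` V0h)) = int (dim (s ` V1)) - int (dim (s ` V1h))) \<and>
         (int (dim V0) - int (dim V0h) = int (dim V1) - int (dim V1h) \<longrightarrow>
          exact_sequence (ker_on V0 d0) V0h d0 V1h d1 V2)"
proof (intro conjI impI)
  obtain S0 where S0: "finite S0" "V0 \<subseteq> span S0"
    using assms(1) by (auto simp: fin_dim_hilbert_def)
  obtain S1 where S1: "finite S1" "V1 \<subseteq> span S1"
    using assms(2) by (auto simp: fin_dim_hilbert_def)
  obtain S2 where S2: "finite S2" "V2 \<subseteq> span S2"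
    using assms(3) by (auto simp: fin_dim_hilbert_def)
  show "int (dim V0) - int (dim V0h) = int (dim V1) - int (dim V1h) \<longleftrightarrow>
      int (dim (d2 ` V0)) - int (dim (d2 ` V0h)) = int (dim (s ` V1)) - int (dim (s ` V1h))"
    using dim_diff_preimage[OF assms(5,8) S0 assms(10)]
      dim_diff_preimage[OF assms(6,8) S1 assms(11)] by simp
  assume dims: "int (dim V0) - int (dim V0h) = int (dim V1) - int (dim V1h)"
  have d0: "d0 ` V0 \<subseteq> V1" and d1: "d1 ` V1 = V2"
    using assms(4) by (auto simp: exact_sequence_def linear_map_on_def)
  have sub: "V0h \<subseteq> V0" "V1h \<subseteq> V1"
    using assms(10,11) by auto
  have "subspace V0h" "subspace V1h"
    using subspace_linear_map_on_preimage assms(5,6,8,10,11) by auto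
  moreover have "d0 u \<in> V1h \<longleftrightarrow> u \<in> V0h" if "u \<in> V0" for u
    using that d0 assms(7,10,11) by auto
  ultimately have ex: "exact_sequence (ker_on V0 d0) V0h d0 V1h d1 (d1 ` V1h)"
    using exact_sequence_restrict[OF assms(4)] sub assms(12) by blast
  have "dim (ker_on V0 d0) + dim V1h = dim V0h + dim (d1 ` V1h)"
    using exact_sequence_dim[OF ex S0(1) _ S1(1)] sub S0(2) S1(2) by blast
  moreover have "dim (ker_on V0 d0) + dim V1 = dim V0 + dim V2"
    using exact_sequence_dim[OF assms(4) S0 S1] .
  ultimately have "dim (d1 ` V1h) = dim V2"
    using dims by linarith
  moreover have "subspace (d1 ` V1h)"
    using ex by (simp add: exact_sequence_def linear_map_on_def)
  moreover have "d1 ` V1h \<subseteq> V2"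
    using sub(2) d1 by blast
  ultimately have "d1 ` V1h = V2"
    using subspace_eq_of_dim_eq S2 by blast
  with ex show "exact_sequence (ker_on V0 d0) V0h d0 V1h d1 V2"
    by simp
qed

end
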